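(* Let $\mu,\nu,q\in\mathbb{C}$ and let $X,Y$ satisfy $XY-qYX=\mu I+\nu Y$ (the $q$-deformed generalized Ore algebra $\mathcal{O}_{\mu,\nu}(q)$). Then for every $m\in\mathbb{N}$, $$(X+Y)^m=\sum_{k=0}^{m}\sum_{\ell=k}^{m}\sum_{t=0}^{\ell-k}\mathfrak{O}_{m,k,\ell,t}(q)\,Y^{m-\ell-t}X^{k},\qquad \mathfrak{O}_{m,k,\ell,t}(q)=\sum_{\lambda\in\mathcal{I}_{m-\ell,\ell}} m_{t,\ell-k-t}(B_{\omega_\lambda};q).$$
   Context: For $0\le\ell\le m$, $\mathcal{I}_{m-\ell,\ell}$ is the set of integer sequences $\lambda=(\lambda_1,\dots,\lambda_\ell)$ with $m-\ell\ge\lambda_1\ge\lambda_2\ge\cdots\ge\lambda_\ell\ge 0$ (Young diagrams in an $(m-\ell)\times\ell$ box; for $\ell=0$ only the empty sequence). For such $\lambda$, $\omega_\lambda=XY^{\lambda_1-\lambda_2}XY^{\lambda_2-\lambda_3}\cdots XY^{\lambda_{\ell-1}-\lambda_\ell}XY^{\lambda_\ell}$ (a word with $\ell$ letters $X$; empty word if $\ell=0$). Board of a word: for a word $\omega$ in $X,Y$, draw the lattice path from $(0,0)$ reading $\omega$ left to right, $X$ a unit step right, $Y$ a unit step up; $B_\omega$ is the Ferrers board of unit cells above the path, with $x\ge0$ and below $y=$ (number of $Y$'s). Equivalently, columns correspond to the $X$'s, rows to the $Y$'s (the $j$-th $Y$ from the left is the $j$-th row from the bottom), and the column of an $X$ has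 a cell in the row of each $Y$ to its right. "Above" means in a higher row. Mixed placements: $\mathcal{M}_{k,\ell}(B)$ is the set of placements of $k$ rooks and $\ell$ files in distinct cells of $B$ such that no two rooks share a row or column, no two files share a column, no file and rook share a column, and no file lies in the same row as a rook and to its left. For such a placement, a cell is cancelled if it contains no rook/file and lies above a rook in its column, or to the left of a rook in its row, or above a file in its column; cells containing nothing and not cancelled are empty boxes. $m_{k,\ell}(B;q)=\mu^k\nu^\ell\sum_{\phi\in\mathcal{M}_{k,\ell}(B)}q^{\#\text{empty boxes of }\phi}$ (so $m_{0,0}(B;q)=q^{|B|}$, and $m_{k,\ell}=0$ if there is no such placement). *)

theory Defs
  imports Complex_Main
begin

locale complex_algebra = vector_space scale
  for scale :: "complex \<Rightarrow> 'a::ring_1 \<Rightarrow> 'a" (infixr "*\<^sub>A" 75) +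
  assumes scale_mult_left: "(c *\<^sub>A x) * y = c *\<^sub>A (x * y)"
    and scale_mult_right: "x * (c *\<^sub>A y) = c *\<^sub>A (x * y)"

text \<open>
  A pair of elements of a complex algebra satisfying the defining relation of the
  \<open>q\<close>-deformed generalized Ore algebra, i.e. the images of its generators under
  an arbitrary representation. Identities proved for all such pairs in all complex algebras
  are the identities between the generators themselves.
\<close>

locale q_ore_pair = complex_algebra scale
  for scale :: "complex \<Rightarrow> 'a::ring_1 \<Rightarrow> 'a" (infixr "*\<^sub>A" 75) +
  fixes \<mu> \<nu> q :: complex and X Y :: 'a
  assumes ore_relation: "X * Y - q *\<^sub>A (Y * X) = \<mu> *\<^sub>A 1 + \<nu> *\<^sub>A Y"

definition box_diagrams :: "nat \<Rightarrow> nat \<Rightarrow> nat list set" where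
  "box_diagrams a l = {ls. length ls = l \<and> sorted_wrt (\<ge>) ls \<and> (\<forall>x\<in>set ls. x \<le> a)}"

datatype letter = LX | LY

fun diagram_word :: "nat list \<Rightarrow> letter list" where
  "diagram_word [] = []"
| "diagram_word [a] = LX # replicate a LY"
| "diagram_word (a # b # ls) = LX # replicate (a - b) LY @ diagram_word (b # ls)"

type_synonym cell = "nat \<times> nat"

text \<open>
  A cell is the pair (column, row), both counted from 0: columns from the left, rows from the
  bottom. It is the unit square with lower left corner at that lattice point. The \<open>X\<close>
  at position \<open>i\<close> of the word is the path's step across the column whose index is the
  number of earlier \<open>X\<close>s, and likewise for \<open>Y\<close>s and rows.
\<close>

definition board :: "letter list \<Rightarrow> cell set" where
  "board w = {(count_list (take i w) LX, count_list (take j w) LY) | i j.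
     i < j \<and> j < length w \<and> w ! i = LX \<and> w ! j = LY}"

text \<open>A placement is a pair (set of cells with a rook, set of cells with a file).\<close>

definition mixed_placements :: "nat \<Rightarrow> nat \<Rightarrow> cell set \<Rightarrow> (cell set \<times> cell set) set" where
  "mixed_placements k l B = {(R, F).
     R \<subseteq> B \<and> F \<subseteq> B \<and> R \<inter> F = {} \<and>
     finite R \<and> card R = k \<and> finite F \<and> card F = l \<and>
     (\<forall>r\<in>R. \<forall>r'\<in>R. r \<noteq> r' \<longrightarrow> fst r \<noteq> fst r' \<and> snd r \<noteq> snd r') \<and>
     (\<forall>f\<in>F. \<forall>f'\<in>F. f \<noteq> f' \<longrightarrow> fst f \<noteq> fst f') \<and>
     (\<forall>f\<in>F. \<forall>r\<in>R. fst f \<noteq> fst r) \<and>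
     (\<forall>f\<in>F. \<forall>r\<in>R. \<not> (snd f = snd r \<and> fst f < fst r))}"

definition cancelled :: "cell set \<Rightarrow> cell set \<Rightarrow> cell \<Rightarrow> bool" where
  "cancelled R F b \<longleftrightarrow> b \<notin> R \<union> F \<and>
     ((\<exists>r\<in>R. fst b = fst r \<and> snd r < snd b) \<or>
      (\<exists>r\<in>R. snd b = snd r \<and> fst b < fst r) \<or>
      (\<exists>f\<in>F. fst b = fst f \<and> snd f < snd b))"

definition empty_boxes :: "cell set \<Rightarrow> cell set \<times> cell set \<Rightarrow> cell set" where
  "empty_boxes B = (\<lambda>(R, F). {b \<in> B. b \<notin> R \<union> F \<and> \<not> cancelled R F b})"

definition mixed_number ::
  "complex \<Rightarrow> complex \<Rightarrow> complex \<Rightarrow> nat \<Rightarrow> nat \<Rightarrow> cell set \<Rightarrow> complex" where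
  "mixed_number \<mu> \<nu> q k l B =
     \<mu> ^ k * \<nu> ^ l * (\<Sum>\<phi>\<in>mixed_placements k l B. q ^ card (empty_boxes B \<phi>))"

definition ore_coeff ::
  "complex \<Rightarrow> complex \<Rightarrow> complex \<Rightarrow> nat \<Rightarrow> nat \<Rightarrow> nat \<Rightarrow> nat \<Rightarrow> complex" where
  "ore_coeff \<mu> \<nu> q m k l t =
     (\<Sum>ls\<in>box_diagrams (m - l) l. mixed_number \<mu> \<nu> q t (l - k - t) (board (diagram_word ls)))"

text \<open>
  The index sets of the sums above are finite, so none of these sums is 0 merely by the
  convention for infinite sums.
\<close>

lemma finite_box_diagrams: "finite (box_diagrams a l)"
  by (rule finite_subset[OF _ finite_lists_length_eq[of "{..a}" l]])
     (auto simp: box_diagrams_def)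

lemma finite_board: "finite (board w)"
proof (rule finite_subset)
  show "board w \<subseteq> (\<lambda>(i, j). (count_list (take i w) LX, count_list (take j w) LY)) `
      ({..<length w} \<times> {..<length w})"
    unfolding board_def by force
qed simp

lemma finite_mixed_placements: "finite B \<Longrightarrow> finite (mixed_placements k l B)"
  by (rule finite_subset[of _ "Pow B \<times> Pow B"]) (auto simp: mixed_placements_def)

end

theory Submission
  imports Defs
begin

text \<open>
  Moving an \<open>X\<close> to the right through \<open>Y ^ p\<close> either crosses all the \<open>Y\<close>s, or is absorbed at
  one of them together with that \<open>Y\<close> (a rook), or is absorbed and leaves that \<open>Y\<close> behind
  (a file); every \<open>Y\<close> crossed contributes a factor \<open>q\<close>. Prepending \<open>X\<close> to a word adds a full
  first column to its board, and the \<open>Y\<close>s still present are the rows without a rook. Hence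
  induction on the word shows that the placements on the board of a word are the terms of
  its normal ordering. Every word in the expansion of the power \<open>(X + Y) ^ m\<close> is a power of \<open>Y\<close>
  times the word of a unique diagram, and the initial \<open>Y\<close>s only add empty rows below the board.
\<close>

section \<open>Placements with any number of rooks and files\<close>

definition placements :: "cell set \<Rightarrow> (cell set \<times> cell set) set" where
  "placements B = {(R, F). (R, F) \<in> mixed_placements (card R) (card F) B}"

text \<open>Subsets of a finite board are finite, and both cardinalities are prescribed as their own
  values, so only the geometric conditions remain.\<close>

lemma placements_iff:
  assumes "finite B"
  shows "(R, F) \<in> placements B \<longleftrightarrow> R \<subseteq> B \<and> F \<subseteq> B \<and> R \<inter> F = {} \<and>
     (\<forall>r\<in>R. \<forall>r'\<in>R. r \<noteq> r' \<longrightarrow> fst r \<noteq> fst r' \<and> snd r \<noteq> snd r') \<and>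
     (\<forall>f\<in>F. \<forall>f'\<in>F. f \<noteq> f' \<longrightarrow> fst f \<noteq> fst f') \<and>
     (\<forall>f\<in>F. \<forall>r\<in>R. fst f \<noteq> fst r) \<and>
     (\<forall>f\<in>F. \<forall>r\<in>R. \<not> (snd f = snd r \<and> fst f < fst r))"
  unfolding placements_def mixed_placements_def
  using assms by (auto simp only: finite_subset mem_Collect_eq case_prod_conv)

lemma mixed_placements_eq:
  "mixed_placements k l B = {\<phi> \<in> placements B. card (fst \<phi>) = k \<and> card (snd \<phi>) = l}"
  unfolding placements_def mixed_placements_def by auto

lemma finite_placements: "finite B \<Longrightarrow> finite (placements B)"
  by (rule finite_subset[of _ "Pow B \<times> Pow B"])
     (auto simp: placements_def mixed_placements_def)

lemma placements_empty: "placements {} = {({}, {})}"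
  by (auto simp: placements_iff)

lemma mem_empty_boxes:
  "b \<in> empty_boxes B (R, F) \<longleftrightarrow> b \<in> B \<and> b \<notin> R \<and> b \<notin> F \<and>
     (\<forall>r\<in>R. \<not> (fst b = fst r \<and> snd r < snd b) \<and> \<not> (snd b = snd r \<and> fst b < fst r)) \<and>
     (\<forall>f\<in>F. \<not> (fst b = fst f \<and> snd f < snd b))"
  by (auto simp: empty_boxes_def cancelled_def)

lemma placements_props:
  assumes "finite B" "(R, F) \<in> placements B"
  shows "R \<subseteq> B" "F \<subseteq> B" "R \<inter> F = {}" "finite R" "finite F"
    "inj_on snd R" "inj_on fst (R \<union> F)"
proof -
  from assms(2)[unfolded placements_iff[OF assms(1)]]
  have sub: "R \<subseteq> B" "F \<subseteq> B" "R \<inter> F = {}"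
    and R: "\<forall>r\<in>R. \<forall>r'\<in>R. r \<noteq> r' \<longrightarrow> fst r \<noteq> fst r' \<and> snd r \<noteq> snd r'"
    and F: "\<forall>f\<in>F. \<forall>f'\<in>F. f \<noteq> f' \<longrightarrow> fst f \<noteq> fst f'"
    and FR: "\<forall>f\<in>F. \<forall>r\<in>R. fst f \<noteq> fst r"
    by simp_all
  show "R \<subseteq> B" "F \<subseteq> B" "R \<inter> F = {}" by fact+
  show "finite R" "finite F" using sub(1,2) assms(1) by (auto intro: finite_subset)
  show "inj_on snd R" unfolding inj_on_def using R by blast
  have "inj_on fst R" unfolding inj_on_def using R by blast
  moreover have "inj_on fst F" unfolding inj_on_def using F by blast
  moreover have "fst ` R \<inter> fst ` F = {}" using FR by fastforce
  ultimately show "inj_on fst (R \<union> F)"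
    unfolding inj_on_Un by blast
qed

text \<open>Rooks inject into the rows, rooks and files together into the columns. Later these
  bounds ensure that the exponents counting the surviving letters are not truncated.\<close>

lemma card_rooks_files_le:
  assumes "finite B" "(R, F) \<in> placements B" "B \<subseteq> {..<c} \<times> {..<n}"
  shows "card R \<le> n" "card R + card F \<le> c"
proof -
  note * = placements_props[OF assms(1,2)]
  have "snd ` R \<subseteq> {..<n}" "fst ` (R \<union> F) \<subseteq> {..<c}" using *(1,2) assms(3) by auto
  then have "card R \<le> n" "card (R \<union> F) \<le> c"
    using card_inj_on_le[OF *(6), of "{..<n}"] card_inj_on_le[OF *(7), of "{..<c}"] by simp_all
  then show "card R \<le> n" "card R + card F \<le> c"
    using *(3-5) by (simp_all add: card_Un_disjoint)
qed

text \<open>Each exponent is the rank of \<open>i\<close> in \<open>A\<close>, and ranks run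
  bijectively through the numbers below \<open>card A\<close>. Thus a sum over the positions of a
  piece in a new column depends only on how many rows are available, not on which ones.\<close>

lemma sum_power_rank:
  fixes q :: "'b::comm_semiring_1" and A :: "'c::linorder set"
  assumes "finite A"
  shows "(\<Sum>i\<in>A. q ^ card {j\<in>A. j < i}) = (\<Sum>i<card A. q ^ i)"
  using assms
proof (induction A rule: finite_linorder_max_induct)
  case (insert b A)
  \<comment> \<open>A new maximum changes no rank of the old elements and itself has rank
    \<open>card A\<close>.\<close>
  have "{j \<in> insert b A. j < i} = {j \<in> A. j < i}" if "i \<in> A" for i
    using insert.hyps that by auto
  moreover have "{j \<in> insert b A. j < b} = A"
    using insert.hyps by auto
  moreover have "b \<notin> A" using insert.hyps by auto
  ultimately show ?case
    using insert by (simp add: add.commute)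
qed simp

section \<open>Translation of boards and placements\<close>

definition shift :: "nat \<Rightarrow> nat \<Rightarrow> cell \<Rightarrow> cell" where
  "shift a b = (\<lambda>(c, r). (c + a, r + b))"

lemma shift_simps [simp]:
  "shift a b (c, r) = (c + a, r + b)" "fst (shift a b x) = fst x + a" "snd (shift a b x) = snd x + b"
  by (auto simp: shift_def split: prod.splits)

lemma inj_shift: "inj (shift a b)"
  by (auto simp: inj_def shift_def)

lemma mem_shift_image_iff [simp]:
  "(c, r) \<in> shift a b ` A \<longleftrightarrow> a \<le> c \<and> b \<le> r \<and> (c - a, r - b) \<in> A"
proof
  assume "a \<le> c \<and> b \<le> r \<and> (c - a, r - b) \<in> A"
  then show "(c, r) \<in> shift a b ` A"
    by (intro image_eqI[of _ _ "(c - a, r - b)"]) auto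
qed (auto simp: shift_def)

lemma shift_eq_iff [simp]: "shift a b x = shift a b y \<longleftrightarrow> x = y"
  by (simp add: inj_shift inj_eq)

lemma card_shift [simp]: "card (shift a b ` A) = card A"
  by (rule card_image[OF inj_on_subset[OF inj_shift subset_UNIV]])

text \<open>The placement conditions only compare columns with columns and rows with rows, and a
  translation preserves equality and order of both.\<close>

lemma placements_shift_iff:
  assumes "finite B"
  shows "(shift a b ` R, shift a b ` F) \<in> placements (shift a b ` B) \<longleftrightarrow> (R, F) \<in> placements B"
  using assms by (simp add: placements_iff inj_image_subset_iff inj_shift
      image_Int[OF inj_shift, symmetric])

lemma placements_shift:
  assumes "finite B"
  shows "placements (shift a b ` B) = (\<lambda>(R, F). (shift a b ` R, shift a b ` F)) ` placements B"
proof (intro equalityI subsetI)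
  fix \<phi> assume \<phi>: "\<phi> \<in> placements (shift a b ` B)"
  obtain R F where RF: "\<phi> = (R, F)" by force
  then have "R \<subseteq> shift a b ` B" "F \<subseteq> shift a b ` B"
    using \<phi> assms by (auto simp: placements_iff)
  then obtain R' F' where "R = shift a b ` R'" "F = shift a b ` F'"
    by (meson subset_imageE)
  then show "\<phi> \<in> (\<lambda>(R, F). (shift a b ` R, shift a b ` F)) ` placements B"
    using \<phi> RF assms by (auto simp: placements_shift_iff)
qed (use assms in \<open>auto simp: placements_shift_iff\<close>)

lemma inj_shift_placement: "inj_on (\<lambda>(R, F). (shift a b ` R, shift a b ` F)) A"
  by (auto simp: inj_on_def inj_image_eq_iff inj_shift)

lemma empty_boxes_shift:
  "empty_boxes (shift a b ` B) (shift a b ` R, shift a b ` F) = shift a b ` empty_boxes B (R, F)"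
proof (rule set_eqI)
  fix x show "x \<in> empty_boxes (shift a b ` B) (shift a b ` R, shift a b ` F) \<longleftrightarrow>
      x \<in> shift a b ` empty_boxes B (R, F)"
    by (cases x) (auto simp: mem_empty_boxes)
qed

section \<open>Boards of words, letter by letter\<close>

lemma boardI:
  "i < j \<Longrightarrow> j < length w \<Longrightarrow> w ! i = LX \<Longrightarrow> w ! j = LY \<Longrightarrow>
    (count_list (take i w) LX, count_list (take j w) LY) \<in> board w"
  by (auto simp: board_def)

lemma boardE:
  assumes "b \<in> board w"
  obtains i j where "b = (count_list (take i w) LX, count_list (take j w) LY)"
    "i < j" "j < length w" "w ! i = LX" "w ! j = LY"
  using assms by (auto simp: board_def)

lemma board_Nil: "board [] = {}"
  by (simp add: board_def)

text \<open>A leading \<open>Y\<close> has no \<open>X\<close> to its left, so it contributes an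
  empty bottom row and pushes all other cells up.\<close>

lemma board_LY: "board (LY # w) = shift 0 (Suc 0) ` board w"
proof (intro equalityI subsetI)
  fix b assume "b \<in> board (LY # w)"
  then obtain i j where ij: "b = (count_list (take i (LY # w)) LX, count_list (take j (LY # w)) LY)"
    "i < j" "j < length (LY # w)" "(LY # w) ! i = LX" "(LY # w) ! j = LY"
    by (rule boardE)
  then obtain i' j' where ij': "i = Suc i'" "j = Suc j'"
    by (cases i; cases j) auto
  then have "b = shift 0 (Suc 0) (count_list (take i' w) LX, count_list (take j' w) LY)"
    using ij by simp
  moreover have "(count_list (take i' w) LX, count_list (take j' w) LY) \<in> board w"
    using ij ij' by (intro boardI) auto
  ultimately show "b \<in> shift 0 (Suc 0) ` board w" by blast
next
  fix b assume "b \<in> shift 0 (Suc 0) ` board w"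
  then obtain i j where ij: "b = (count_list (take i w) LX, Suc (count_list (take j w) LY))"
    "i < j" "j < length w" "w ! i = LX" "w ! j = LY"
    by (auto elim: boardE)
  then show "b \<in> board (LY # w)"
    using boardI[of "Suc i" "Suc j" "LY # w"] by simp
qed

lemma count_list_take_less:
  "j < length w \<Longrightarrow> w ! j = x \<Longrightarrow> count_list (take j w) x < count_list w x"
proof (induction w arbitrary: j)
  case (Cons a w)
  then show ?case by (cases j) auto
qed simp

text \<open>Prefix counts grow in unit steps, so every value below the total occurs just before some
  \<open>x\<close>. This fills the first column of \<open>board (LX # w)\<close> without
  gaps.\<close>

lemma ex_count_list_take:
  "r < count_list w x \<Longrightarrow> \<exists>j<length w. w ! j = x \<and> count_list (take j w) x = r"
proof (induction w arbitrary: r)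
  case (Cons a w)
  show ?case
  proof (cases "a = x \<and> r = 0")
    case True
    then show ?thesis by (intro exI[of _ 0]) auto
  next
    case False
    then have "r - (if a = x then 1 else 0) < count_list w x"
      using Cons.prems by (auto split: if_splits)
    then obtain j where "j < length w" "w ! j = x"
      "count_list (take j w) x = r - (if a = x then 1 else 0)"
      using Cons.IH by blast
    then show ?thesis
      using False by (intro exI[of _ "Suc j"]) auto
  qed
qed simp

text \<open>The height \<open>n\<close> is a separate parameter because the new column also meets
  rows that are empty in \<open>B\<close>, such as those of leading letters
  \<open>Y\<close>.\<close>

definition add_column :: "nat \<Rightarrow> cell set \<Rightarrow> cell set" where
  "add_column n B = {0} \<times> {..<n} \<union> shift (Suc 0) 0 ` B"

text \<open>Every \<open>Y\<close> of \<open>w\<close> is to the right of the leading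
  \<open>X\<close>, which makes column 0 full; the columns of the other letters \<open>X\<close>
  move right by one.\<close>

lemma board_LX: "board (LX # w) = add_column (count_list w LY) (board w)"
  unfolding add_column_def
proof (intro equalityI subsetI)
  fix b assume "b \<in> board (LX # w)"
  then obtain i j where ij: "b = (count_list (take i (LX # w)) LX, count_list (take j (LX # w)) LY)"
    "i < j" "j < length (LX # w)" "(LX # w) ! i = LX" "(LX # w) ! j = LY"
    by (rule boardE)
  then obtain j' where j': "j = Suc j'" by (cases j) auto
  show "b \<in> {0} \<times> {..<count_list w LY} \<union> shift (Suc 0) 0 ` board w"
  proof (cases i)
    case 0
    then have "b = (0, count_list (take j' w) LY)" "j' < length w" "w ! j' = LY"
      using ij j' by simp_all
    then show ?thesis using count_list_take_less[of j' w LY] by simp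
  next
    case (Suc i')
    then have "b = shift (Suc 0) 0 (count_list (take i' w) LX, count_list (take j' w) LY)"
      using ij j' by simp
    moreover have "(count_list (take i' w) LX, count_list (take j' w) LY) \<in> board w"
      using ij j' Suc by (intro boardI) auto
    ultimately show ?thesis by blast
  qed
next
  fix b assume "b \<in> {0} \<times> {..<count_list w LY} \<union> shift (Suc 0) 0 ` board w"
  then consider r where "b = (0, r)" "r < count_list w LY" | "b \<in> shift (Suc 0) 0 ` board w"
    by auto
  then show "b \<in> board (LX # w)"
  proof cases
    case 1
    then obtain j where "j < length w" "w ! j = LY" "count_list (take j w) LY = r"
      using ex_count_list_take[of r w LY] by auto
    with 1 show ?thesis
      using boardI[of 0 "Suc j" "LX # w"] by simp
  next
    case 2
    then obtain i j where ij: "b = (Suc (count_list (take i w) LX), count_list (take j w) LY)"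
      "i < j" "j < length w" "w ! i = LX" "w ! j = LY"
      by (auto elim: boardE)
    then show ?thesis
      using boardI[of "Suc i" "Suc j" "LX # w"] by simp
  qed
qed

lemma board_subset: "board w \<subseteq> {..<count_list w LX} \<times> {..<count_list w LY}"
  by (auto elim!: boardE simp: count_list_take_less)

section \<open>Placements on a board with a new first column\<close>

lemma mem_add_column [simp]:
  "(c, r) \<in> add_column n B \<longleftrightarrow> (if c = 0 then r < n else (c - 1, r) \<in> B)"
  by (auto simp: add_column_def)

lemma shift_mem_add_column [simp]: "shift (Suc 0) 0 x \<in> add_column n B \<longleftrightarrow> x \<in> B"
  by (cases x) simp

lemma shift_subset_add_column [simp]: "shift (Suc 0) 0 ` A \<subseteq> add_column n B \<longleftrightarrow> A \<subseteq> B"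
  unfolding image_subset_iff shift_mem_add_column by blast

text \<open>These are the rows of the letters \<open>Y\<close> that survive the placement: a rook
  consumes the \<open>Y\<close> of its row, a file leaves it in place.\<close>

definition free_rows :: "nat \<Rightarrow> cell set \<Rightarrow> nat set" where
  "free_rows n R = {..<n} - snd ` R"

lemma mem_free_rows: "i \<in> free_rows n R \<longleftrightarrow> i < n \<and> (\<forall>r\<in>R. snd r \<noteq> i)"
  by (auto simp: free_rows_def)

lemma finite_add_column: "finite B \<Longrightarrow> finite (add_column n B)"
  by (simp add: add_column_def)

lemma shift_Int [simp]: "shift a b ` R \<inter> shift a b ` F = shift a b ` (R \<inter> F)"
  by (simp add: image_Int inj_shift)

lemma placements_add_column_empty_iff:
  assumes "finite B"
  shows "(shift (Suc 0) 0 ` R, shift (Suc 0) 0 ` F) \<in> placements (add_column n B) \<longleftrightarrow> (R, F) \<in> placements B"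
  using assms by (simp add: placements_iff finite_add_column)

text \<open>All other pieces lie strictly to the right of column 0. Hence the new rook conflicts
  only with a rook in its row, and it never lies to the right of a file.\<close>

lemma placements_add_column_rook_iff:
  assumes "finite B"
  shows "(insert (0, i) (shift (Suc 0) 0 ` R), shift (Suc 0) 0 ` F) \<in> placements (add_column n B) \<longleftrightarrow>
    (R, F) \<in> placements B \<and> i \<in> free_rows n R"
  using assms by (auto simp: placements_iff finite_add_column mem_free_rows)

text \<open>Files may share a row, but a rook in row \<open>i\<close> would lie to the right of the
  new file, so \<open>i\<close> again ranges over the rows without a rook.\<close>

lemma placements_add_column_file_iff:
  assumes "finite B"
  shows "(shift (Suc 0) 0 ` R, insert (0, i) (shift (Suc 0) 0 ` F)) \<in> placements (add_column n B) \<longleftrightarrow>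
    (R, F) \<in> placements B \<and> i \<in> free_rows n R"
  using assms by (auto simp: placements_iff finite_add_column mem_free_rows)

text \<open>The preimage under the shift drops column 0 and renumbers the remaining columns; it
  recovers the old placement from an enlarged one.\<close>

lemma split_first_column:
  "A = {x \<in> A. fst x = 0} \<union> shift (Suc 0) 0 ` (shift (Suc 0) 0 -` A)"
proof -
  have "x \<in> shift (Suc 0) 0 ` (shift (Suc 0) 0 -` A)" if "x \<in> A" "fst x \<noteq> 0" for x
  proof (rule image_eqI)
    show "x = shift (Suc 0) 0 (fst x - 1, snd x)" using that by (cases x) simp
    then show "(fst x - 1, snd x) \<in> shift (Suc 0) 0 -` A" using that by simp
  qed
  then show ?thesis by auto
qed

definition put_empty :: "cell set \<times> cell set \<Rightarrow> cell set \<times> cell set" where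
  "put_empty = (\<lambda>(R, F). (shift (Suc 0) 0 ` R, shift (Suc 0) 0 ` F))"

definition put_rook :: "(cell set \<times> cell set) \<times> nat \<Rightarrow> cell set \<times> cell set" where
  "put_rook = (\<lambda>((R, F), i). (insert (0, i) (shift (Suc 0) 0 ` R), shift (Suc 0) 0 ` F))"

definition put_file :: "(cell set \<times> cell set) \<times> nat \<Rightarrow> cell set \<times> cell set" where
  "put_file = (\<lambda>((R, F), i). (shift (Suc 0) 0 ` R, insert (0, i) (shift (Suc 0) 0 ` F)))"

lemmas put_defs = put_empty_def put_rook_def put_file_def

text \<open>Column 0 holds at most one piece, which leaves three possibilities: nothing, a rook or a
  file. The three maps are injective with disjoint ranges, so sums over placements split
  accordingly.\<close>

lemma placements_add_column:
  assumes "finite B"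
  shows "placements (add_column n B) = put_empty ` placements B \<union>
    (put_rook ` (SIGMA \<phi>:placements B. free_rows n (fst \<phi>)) \<union>
     put_file ` (SIGMA \<phi>:placements B. free_rows n (fst \<phi>)))" (is "?L = ?E \<union> (?R \<union> ?F)")
proof (intro equalityI subsetI)
  fix \<phi> assume \<phi>: "\<phi> \<in> ?L"
  obtain R F where RF: "\<phi> = (R, F)" by force
  note P = placements_props[OF finite_add_column[OF assms] \<phi>[unfolded RF]]
  \<comment> \<open>Distinct pieces have distinct columns, so a piece in column 0 is the only one
    there.\<close>
  have first: "x = (0, i)" if "x \<in> R \<union> F" "(0, i) \<in> R \<union> F" "fst x = 0" for x i
    using inj_onD[OF P(7) _ that(1,2)] that(3) by simp
  define R' F' where "R' = shift (Suc 0) 0 -` R" and "F' = shift (Suc 0) 0 -` F"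
  have R: "R = A \<union> shift (Suc 0) 0 ` R'" if "{x \<in> R. fst x = 0} = A" for A
    unfolding R'_def that[symmetric] by (rule split_first_column)
  have F: "F = A \<union> shift (Suc 0) 0 ` F'" if "{x \<in> F. fst x = 0} = A" for A
    unfolding F'_def that[symmetric] by (rule split_first_column)
  consider i where "(0, i) \<in> R" | i where "(0, i) \<in> F"
    | "\<forall>i. (0, i) \<notin> R" "\<forall>i. (0, i) \<notin> F" by blast
  then show "\<phi> \<in> ?E \<union> (?R \<union> ?F)"
  proof cases
    case 1
    have "x = (0, i)" if "x \<in> R \<union> F" "fst x = 0" for x
      using first[OF that(1) _ that(2)] 1 by simp
    moreover have "(0, i) \<notin> F" using 1 P(3) by blast
    moreover have "fst (0, i) = 0" by simp
    ultimately have z: "{x \<in> R. fst x = 0} = {(0, i)}" "{x \<in> F. fst x = 0} = {}"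
      using 1 by (blast, blast)
    have "\<phi> = (insert (0, i) (shift (Suc 0) 0 ` R'), shift (Suc 0) 0 ` F')"
      using R[OF z(1)] F[OF z(2)] RF by simp
    then have "\<phi> = put_rook ((R', F'), i)" "(R', F') \<in> placements B" "i \<in> free_rows n R'"
      using \<phi> assms by (simp_all add: put_defs placements_add_column_rook_iff)
    then have "\<phi> \<in> ?R" by (intro image_eqI) auto
    then show ?thesis by blast
  next
    case 2
    have "x = (0, i)" if "x \<in> R \<union> F" "fst x = 0" for x
      using first[OF that(1) _ that(2)] 2 by simp
    moreover have "(0, i) \<notin> R" using 2 P(3) by blast
    moreover have "fst (0, i) = 0" by simp
    ultimately have z: "{x \<in> F. fst x = 0} = {(0, i)}" "{x \<in> R. fst x = 0} = {}"
      using 2 by (blast, blast)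
    have "\<phi> = (shift (Suc 0) 0 ` R', insert (0, i) (shift (Suc 0) 0 ` F'))"
      using R[OF z(2)] F[OF z(1)] RF by simp
    then have "\<phi> = put_file ((R', F'), i)" "(R', F') \<in> placements B" "i \<in> free_rows n R'"
      using \<phi> assms by (simp_all add: put_defs placements_add_column_file_iff)
    then have "\<phi> \<in> ?F" by (intro image_eqI) auto
    then show ?thesis by blast
  next
    case 3
    then have z: "{x \<in> R. fst x = 0} = {}" "{x \<in> F. fst x = 0} = {}"
      by (auto intro!: gr0I)
    have "\<phi> = (shift (Suc 0) 0 ` R', shift (Suc 0) 0 ` F')"
      using R[OF z(1)] F[OF z(2)] RF by simp
    then have "\<phi> = put_empty (R', F')" "(R', F') \<in> placements B"
      using \<phi> assms by (simp_all add: put_defs placements_add_column_empty_iff)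
    then show ?thesis by blast
  qed
next
  fix \<phi> assume "\<phi> \<in> ?E \<union> (?R \<union> ?F)"
  then show "\<phi> \<in> ?L"
    using assms
    by (auto simp: put_defs placements_add_column_empty_iff placements_add_column_rook_iff
        placements_add_column_file_iff)
qed

lemma inj_put_empty: "inj_on put_empty A"
  unfolding put_defs by (rule inj_shift_placement)

lemma insert_zero_shift_eq_iff:
  "insert (0, i) (shift (Suc 0) 0 ` R) = insert (0, j) (shift (Suc 0) 0 ` S) \<longleftrightarrow> i = j \<and> R = S"
proof
  assume eq: "insert (0, i) (shift (Suc 0) 0 ` R) = insert (0, j) (shift (Suc 0) 0 ` S)"
  then have "(0, i) \<in> insert (0, j) (shift (Suc 0) 0 ` S)" by blast
  then have "i = j" by simp
  with eq have "shift (Suc 0) 0 ` R = shift (Suc 0) 0 ` S"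
    by (simp add: insert_ident)
  then show "i = j \<and> R = S" using \<open>i = j\<close> by (simp only: inj_image_eq_iff[OF inj_shift])
qed simp

lemma inj_put_rook: "inj_on put_rook A"
  unfolding put_defs inj_on_def
  by (simp add: insert_zero_shift_eq_iff inj_image_eq_iff[OF inj_shift] split: prod.splits)

lemma inj_put_file: "inj_on put_file A"
  unfolding put_defs inj_on_def
  by (simp add: insert_zero_shift_eq_iff inj_image_eq_iff[OF inj_shift] split: prod.splits)

lemma insert_zero_neq_shift: "insert (0, i) A \<noteq> shift (Suc a) b ` C"
proof
  assume "insert (0, i) A = shift (Suc a) b ` C"
  then have "(0, i) \<in> shift (Suc a) b ` C" by (metis insertI1)
  then show False by simp
qed

text \<open>The three constructions are told apart by whether the rooks, the files or neither of
  them meet column 0.\<close>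

lemma put_disjoint:
  "put_empty ` A \<inter> (put_rook ` C \<union> put_file ` C') = {}" "put_rook ` C \<inter> put_file ` C' = {}"
proof -
  have "put_empty \<phi> \<noteq> put_rook \<psi>" "put_empty \<phi> \<noteq> put_file \<psi>" "put_rook \<psi> \<noteq> put_file \<psi>'" for \<phi> \<psi> \<psi>'
    unfolding put_defs
    by (simp_all add: insert_zero_neq_shift insert_zero_neq_shift[symmetric] split: prod.splits)
  then show "put_empty ` A \<inter> (put_rook ` C \<union> put_file ` C') = {}"
    "put_rook ` C \<inter> put_file ` C' = {}" by blast+
qed

text \<open>A cell of the new column is cancelled exactly when a rook lies to its right; files
  cancel nothing to their left.\<close>

lemma empty_boxes_put_empty:
  "empty_boxes (add_column n B) (put_empty (R, F)) =
    {0} \<times> free_rows n R \<union> shift (Suc 0) 0 ` empty_boxes B (R, F)"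
  by (rule set_eqI, case_tac x) (auto simp: put_defs mem_empty_boxes mem_free_rows)

text \<open>Nothing lies to the left of column 0, so the new piece cancels only cells above it and
  all old empty boxes survive. The same reasoning covers a file.\<close>

lemma empty_boxes_put_rook:
  assumes "i \<in> free_rows n R"
  shows "empty_boxes (add_column n B) (put_rook ((R, F), i)) =
    {0} \<times> {j \<in> free_rows n R. j < i} \<union> shift (Suc 0) 0 ` empty_boxes B (R, F)"
  using assms
  by (intro set_eqI, case_tac x) (auto simp: put_defs mem_empty_boxes mem_free_rows)

lemma empty_boxes_put_file:
  assumes "i \<in> free_rows n R"
  shows "empty_boxes (add_column n B) (put_file ((R, F), i)) =
    {0} \<times> {j \<in> free_rows n R. j < i} \<union> shift (Suc 0) 0 ` empty_boxes B (R, F)"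
  using assms
  by (intro set_eqI, case_tac x) (auto simp: put_defs mem_empty_boxes mem_free_rows)

lemma card_first_column_Un:
  "finite A \<Longrightarrow> finite E \<Longrightarrow> card ({0} \<times> A \<union> shift (Suc 0) 0 ` E) = card A + card E"
  by (subst card_Un_disjoint) (auto simp: card_cartesian_product)

section \<open>Weights of placements\<close>

definition placement_weight ::
  "complex \<Rightarrow> complex \<Rightarrow> complex \<Rightarrow> cell set \<Rightarrow> cell set \<times> cell set \<Rightarrow> complex" where
  "placement_weight \<mu> \<nu> q B \<phi> =
     \<mu> ^ card (fst \<phi>) * \<nu> ^ card (snd \<phi>) * q ^ card (empty_boxes B \<phi>)"

lemma card_free_rows:
  assumes "finite B" "B \<subseteq> UNIV \<times> {..<n}" "(R, F) \<in> placements B"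
  shows "card (free_rows n R) = n - card R"
proof -
  note * = placements_props[OF assms(1,3)]
  have "snd ` R \<subseteq> {..<n}" using *(1) assms(2) by auto
  then show ?thesis
    using *(4,6) unfolding free_rows_def by (simp add: card_Diff_subset card_image)
qed

lemma finite_free_rows: "finite (free_rows n R)"
  by (simp add: free_rows_def)

text \<open>A piece in row \<open>i\<close> leaves one empty box for each free row below
  \<open>i\<close>: these are the letters \<open>Y\<close> that the new \<open>X\<close> crosses
  before it is absorbed.\<close>

lemma placement_weight_put:
  assumes "finite B" "B \<subseteq> UNIV \<times> {..<n}" "(R, F) \<in> placements B"
  shows "placement_weight \<mu> \<nu> q (add_column n B) (put_empty (R, F)) =
      placement_weight \<mu> \<nu> q B (R, F) * q ^ (n - card R)" (is ?empty)
    and "i \<in> free_rows n R \<Longrightarrow> placement_weight \<mu> \<nu> q (add_column n B) (put_rook ((R, F), i)) =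
      placement_weight \<mu> \<nu> q B (R, F) * (\<mu> * q ^ card {j \<in> free_rows n R. j < i})"
    and "i \<in> free_rows n R \<Longrightarrow> placement_weight \<mu> \<nu> q (add_column n B) (put_file ((R, F), i)) =
      placement_weight \<mu> \<nu> q B (R, F) * (\<nu> * q ^ card {j \<in> free_rows n R. j < i})"
    and "card (fst (put_empty (R, F))) = card R" "card (snd (put_empty (R, F))) = card F"
    and "card (fst (put_rook ((R, F), i))) = Suc (card R)" "card (snd (put_rook ((R, F), i))) = card F"
    and "card (fst (put_file ((R, F), i))) = card R" "card (snd (put_file ((R, F), i))) = Suc (card F)"
proof -
  note fin = placements_props(4,5)[OF assms(1,3)]
  have fin_empty: "finite (empty_boxes B (R, F))"
    by (rule finite_subset[OF _ assms(1)]) (auto simp: mem_empty_boxes)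
  show cards: "card (fst (put_empty (R, F))) = card R" "card (snd (put_empty (R, F))) = card F"
    "card (fst (put_rook ((R, F), i))) = Suc (card R)" "card (snd (put_rook ((R, F), i))) = card F"
    "card (fst (put_file ((R, F), i))) = card R" "card (snd (put_file ((R, F), i))) = Suc (card F)" for i
    using fin by (simp_all add: put_defs)
  show ?empty
    by (simp add: placement_weight_def cards empty_boxes_put_empty card_first_column_Un fin_empty
        finite_free_rows card_free_rows[OF assms] power_add)
  show "placement_weight \<mu> \<nu> q (add_column n B) (put_rook ((R, F), i)) =
      placement_weight \<mu> \<nu> q B (R, F) * (\<mu> * q ^ card {j \<in> free_rows n R. j < i})"
    if "i \<in> free_rows n R"
    by (simp add: placement_weight_def cards empty_boxes_put_rook[OF that] card_first_column_Un fin_empty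
        finite_free_rows power_add)
  show "placement_weight \<mu> \<nu> q (add_column n B) (put_file ((R, F), i)) =
      placement_weight \<mu> \<nu> q B (R, F) * (\<nu> * q ^ card {j \<in> free_rows n R. j < i})"
    if "i \<in> free_rows n R"
    by (simp add: placement_weight_def cards empty_boxes_put_file[OF that] card_first_column_Un fin_empty
        finite_free_rows power_add)
qed

section \<open>Sums over placements with values in the algebra\<close>

context complex_algebra
begin

text \<open>The family \<open>g\<close> sees only the numbers of rooks and files, since the normally
  ordered monomial left by a placement depends on nothing else.\<close>

definition placement_sum ::
  "complex \<Rightarrow> complex \<Rightarrow> complex \<Rightarrow> cell set \<Rightarrow> (nat \<Rightarrow> nat \<Rightarrow> 'a) \<Rightarrow> 'a" where
  "placement_sum \<mu> \<nu> q B g =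
    (\<Sum>\<phi>\<in>placements B. placement_weight \<mu> \<nu> q B \<phi> *\<^sub>A g (card (fst \<phi>)) (card (snd \<phi>)))"

lemma placement_sum_cong:
  assumes "\<And>R F. (R, F) \<in> placements B \<Longrightarrow> g (card R) (card F) = h (card R) (card F)"
  shows "placement_sum \<mu> \<nu> q B g = placement_sum \<mu> \<nu> q B h"
  unfolding placement_sum_def using assms by (intro sum.cong) auto

lemma mult_placement_sum:
  "x * placement_sum \<mu> \<nu> q B g = placement_sum \<mu> \<nu> q B (\<lambda>r f. x * g r f)"
  by (simp add: placement_sum_def sum_distrib_left scale_mult_right)

lemma placement_sum_shift:
  assumes "finite B"
  shows "placement_sum \<mu> \<nu> q (shift a b ` B) g = placement_sum \<mu> \<nu> q B g"
  unfolding placement_sum_def placements_shift[OF assms]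
  by (subst sum.reindex[OF inj_shift_placement], intro sum.cong)
     (auto simp: placement_weight_def empty_boxes_shift)

text \<open>Summing over the free rows turns the powers of \<open>q\<close> into a geometric sum, by
  \<open>sum_power_rank\<close>. The result has the shape of the rule for moving \<open>X\<close>
  through \<open>Y ^ (n - r)\<close>, which is \<open>X_mult_Y_power\<close> on the algebraic
  side.\<close>

lemma placement_sum_add_column:
  assumes "finite B" "B \<subseteq> UNIV \<times> {..<n}"
  shows "placement_sum \<mu> \<nu> q (add_column n B) g = placement_sum \<mu> \<nu> q B (\<lambda>r f.
    q ^ (n - r) *\<^sub>A g r f + (\<Sum>i<n - r. q ^ i) *\<^sub>A (\<mu> *\<^sub>A g (Suc r) f + \<nu> *\<^sub>A g r (Suc f)))"
proof -
  let ?w = "placement_weight \<mu> \<nu> q"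
  define h where "h \<phi> = ?w (add_column n B) \<phi> *\<^sub>A g (card (fst \<phi>)) (card (snd \<phi>))" for \<phi>
  let ?S = "SIGMA \<phi>:placements B. free_rows n (fst \<phi>)"
  have fin: "finite (placements B)" "finite ?S"
    using finite_placements[OF assms(1)] finite_free_rows by auto
  have "placement_sum \<mu> \<nu> q (add_column n B) g =
      sum h (put_empty ` placements B \<union> (put_rook ` ?S \<union> put_file ` ?S))"
    by (simp add: placement_sum_def h_def placements_add_column[OF assms(1)])
  also have "\<dots> = sum h (put_empty ` placements B) + (sum h (put_rook ` ?S) + sum h (put_file ` ?S))"
    using fin by (simp add: sum.union_disjoint put_disjoint)
  also have "\<dots> = (\<Sum>\<phi>\<in>placements B. h (put_empty \<phi>)) +
      ((\<Sum>\<phi>\<in>placements B. \<Sum>i\<in>free_rows n (fst \<phi>). h (put_rook (\<phi>, i))) +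
       (\<Sum>\<phi>\<in>placements B. \<Sum>i\<in>free_rows n (fst \<phi>). h (put_file (\<phi>, i))))"
    using fin by (simp add: sum.reindex inj_put_empty inj_put_rook inj_put_file sum.Sigma
        finite_free_rows case_prod_beta)
  also have "\<dots> = (\<Sum>\<phi>\<in>placements B. h (put_empty \<phi>) +
      ((\<Sum>i\<in>free_rows n (fst \<phi>). h (put_rook (\<phi>, i))) +
       (\<Sum>i\<in>free_rows n (fst \<phi>). h (put_file (\<phi>, i)))))"
    by (simp add: sum.distrib)
  also have "\<dots> = placement_sum \<mu> \<nu> q B (\<lambda>r f.
    q ^ (n - r) *\<^sub>A g r f + (\<Sum>i<n - r. q ^ i) *\<^sub>A (\<mu> *\<^sub>A g (Suc r) f + \<nu> *\<^sub>A g r (Suc f)))"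
    unfolding placement_sum_def
  proof (rule sum.cong[OF refl])
    fix \<phi> assume "\<phi> \<in> placements B"
    moreover obtain R F where RF: "\<phi> = (R, F)" by force
    ultimately have P: "(R, F) \<in> placements B" by simp
    note put = placement_weight_put[OF assms P]
    let ?N = "\<Sum>i<n - card R. q ^ i"
    have N: "(\<Sum>i\<in>free_rows n R. q ^ card {j \<in> free_rows n R. j < i}) = ?N"
      using sum_power_rank[OF finite_free_rows] card_free_rows[OF assms P] by metis
    have "(\<Sum>i\<in>free_rows n R. h (put_rook ((R, F), i))) =
        (\<Sum>i\<in>free_rows n R. (?w B (R, F) * \<mu> * q ^ card {j \<in> free_rows n R. j < i})
           *\<^sub>A g (Suc (card R)) (card F))"
      by (intro sum.cong) (simp_all add: h_def put mult.assoc)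
    also have "\<dots> = (?w B (R, F) * ?N * \<mu>) *\<^sub>A g (Suc (card R)) (card F)"
      unfolding scale_sum_left[symmetric] sum_distrib_left[symmetric] N by (simp add: mult_ac)
    finally have rook_sum: "(\<Sum>i\<in>free_rows n R. h (put_rook ((R, F), i))) = \<dots>" .
    have "(\<Sum>i\<in>free_rows n R. h (put_file ((R, F), i))) =
        (\<Sum>i\<in>free_rows n R. (?w B (R, F) * \<nu> * q ^ card {j \<in> free_rows n R. j < i})
           *\<^sub>A g (card R) (Suc (card F)))"
      by (intro sum.cong) (simp_all add: h_def put mult.assoc)
    also have "\<dots> = (?w B (R, F) * ?N * \<nu>) *\<^sub>A g (card R) (Suc (card F))"
      unfolding scale_sum_left[symmetric] sum_distrib_left[symmetric] N by (simp add: mult_ac)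
    finally have file_sum: "(\<Sum>i\<in>free_rows n R. h (put_file ((R, F), i))) = \<dots>" .
    show "h (put_empty \<phi>) + ((\<Sum>i\<in>free_rows n (fst \<phi>). h (put_rook (\<phi>, i))) +
          (\<Sum>i\<in>free_rows n (fst \<phi>). h (put_file (\<phi>, i)))) =
        ?w B \<phi> *\<^sub>A (q ^ (n - card (fst \<phi>)) *\<^sub>A g (card (fst \<phi>)) (card (snd \<phi>)) +
          (\<Sum>i<n - card (fst \<phi>). q ^ i) *\<^sub>A
            (\<mu> *\<^sub>A g (Suc (card (fst \<phi>))) (card (snd \<phi>)) + \<nu> *\<^sub>A g (card (fst \<phi>)) (Suc (card (snd \<phi>)))))"
      by (simp add: RF rook_sum file_sum) (simp add: h_def put scale_right_distrib mult.assoc)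
  qed
  finally show ?thesis .
qed

text \<open>The sum is regrouped by the number \<open>t\<close> of rooks and, with \<open>l\<close>
  read as the number of columns, the number \<open>k\<close> of columns without a piece; then
  \<open>l - k - t\<close> counts the files.\<close>

lemma placement_sum_eq_mixed_numbers:
  assumes "finite B" and "\<And>R F. (R, F) \<in> placements B \<Longrightarrow> card R + card F \<le> l"
  shows "placement_sum \<mu> \<nu> q B g =
    (\<Sum>k=0..l. \<Sum>t=0..l-k. mixed_number \<mu> \<nu> q t (l - k - t) B *\<^sub>A g t (l - k - t))"
proof -
  let ?f = "\<lambda>\<phi> :: cell set \<times> cell set. (l - card (fst \<phi>) - card (snd \<phi>), card (fst \<phi>))"
  let ?h = "\<lambda>\<phi>. placement_weight \<mu> \<nu> q B \<phi> *\<^sub>A g (card (fst \<phi>)) (card (snd \<phi>))"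
  let ?S = "SIGMA k:{0..l}. {0..l-k}"
  have le: "card (fst \<phi>) + card (snd \<phi>) \<le> l" if "\<phi> \<in> placements B" for \<phi>
    using assms(2)[of "fst \<phi>" "snd \<phi>"] that by simp
  \<comment> \<open>The bound \<open>le\<close> makes the first component of \<open>?f\<close> a
    genuine difference, so \<open>(k, t)\<close> determines both numbers of pieces.\<close>
  have fibre: "{\<phi> \<in> placements B. ?f \<phi> = (k, t)} = mixed_placements t (l - k - t) B"
    if "k \<le> l" "t \<le> l - k" for k t
    unfolding mixed_placements_eq using that le by fastforce
  have "placement_sum \<mu> \<nu> q B g = (\<Sum>p\<in>?S. sum ?h {\<phi> \<in> placements B. ?f \<phi> = p})"
    unfolding placement_sum_def using finite_placements[OF assms(1)]
    by (intro sum.group[symmetric]) (auto dest: le)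
  also have "\<dots> = (\<Sum>k=0..l. \<Sum>t=0..l-k. sum ?h {\<phi> \<in> placements B. ?f \<phi> = (k, t)})"
    by (rule trans[OF sum.cong[OF refl] sum.Sigma[symmetric]]) auto
  also have "\<dots> = (\<Sum>k=0..l. \<Sum>t=0..l-k. mixed_number \<mu> \<nu> q t (l - k - t) B *\<^sub>A g t (l - k - t))"
  proof (intro sum.cong refl)
    fix k t assume "k \<in> {0..l}" "t \<in> {0..l-k}"
    then have "sum ?h {\<phi> \<in> placements B. ?f \<phi> = (k, t)} = sum ?h (mixed_placements t (l - k - t) B)"
      using fibre by auto
    also have "\<dots> = (\<Sum>\<phi>\<in>mixed_placements t (l - k - t) B.
        (\<mu> ^ t * \<nu> ^ (l - k - t) * q ^ card (empty_boxes B \<phi>)) *\<^sub>A g t (l - k - t))"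
      by (intro sum.cong) (auto simp: mixed_placements_eq placement_weight_def)
    finally show "sum ?h {\<phi> \<in> placements B. ?f \<phi> = (k, t)} =
        mixed_number \<mu> \<nu> q t (l - k - t) B *\<^sub>A g t (l - k - t)"
      by (simp add: mixed_number_def sum_distrib_left scale_sum_left)
  qed
  finally show ?thesis .
qed

end

section \<open>Diagrams in a box and their words\<close>

lemma box_diagrams_0_right: "box_diagrams a 0 = {[]}"
  by (auto simp: box_diagrams_def)

lemma box_diagrams_0_Suc: "box_diagrams 0 (Suc l) = (#) 0 ` box_diagrams 0 l"
proof (intro equalityI subsetI)
  fix ls assume "ls \<in> box_diagrams 0 (Suc l)"
  then show "ls \<in> (#) 0 ` box_diagrams 0 l"
    by (cases ls) (auto simp: box_diagrams_def)
qed (auto simp: box_diagrams_def)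

text \<open>The split is by whether the first part attains the maximum \<open>Suc a\<close>. It
  becomes the split of words by their first letter: \<open>X\<close> if it does, \<open>Y\<close> if
  not.\<close>

lemma box_diagrams_Suc_Suc:
  "box_diagrams (Suc a) (Suc l) = box_diagrams a (Suc l) \<union> (#) (Suc a) ` box_diagrams (Suc a) l"
proof (intro equalityI subsetI)
  fix ls assume ls: "ls \<in> box_diagrams (Suc a) (Suc l)"
  then obtain x xs where x: "ls = x # xs" by (cases ls) (auto simp: box_diagrams_def)
  show "ls \<in> box_diagrams a (Suc l) \<union> (#) (Suc a) ` box_diagrams (Suc a) l"
    using ls x by (cases "x = Suc a") (force simp: box_diagrams_def)+
qed (auto simp: box_diagrams_def le_Suc_eq)

lemma box_diagrams_Suc_disjoint:
  "box_diagrams a (Suc l) \<inter> (#) (Suc a) ` box_diagrams (Suc a) l = {}"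
  by (auto simp: box_diagrams_def)

text \<open>The value 0 for the empty diagram acts as a part after the last one and lets
  \<open>diagram_word_Cons\<close> treat all cases alike.\<close>

definition top_part :: "nat list \<Rightarrow> nat" where
  "top_part ls = (case ls of [] \<Rightarrow> 0 | x # _ \<Rightarrow> x)"

lemma top_part_le: "ls \<in> box_diagrams a l \<Longrightarrow> top_part ls \<le> a"
  by (auto simp: box_diagrams_def top_part_def split: list.split)

lemma diagram_word_Cons:
  "diagram_word (a # ls) = LX # replicate (a - top_part ls) LY @ diagram_word ls"
  by (cases ls) (auto simp: top_part_def)

lemma count_list_replicate: "count_list (replicate n x) y = (if x = y then n else 0)"
  by (induction n) auto

lemma count_LX_diagram_word: "count_list (diagram_word ls) LX = length ls"
  by (induction ls) (auto simp: diagram_word_Cons count_list_replicate simp del: diagram_word.simps(2,3))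

text \<open>The lengths of the blocks of letters \<open>Y\<close> are successive differences of
  parts and telescope; sortedness keeps them from being truncated.\<close>

lemma count_LY_diagram_word:
  "sorted_wrt (\<ge>) ls \<Longrightarrow> count_list (diagram_word ls) LY = top_part ls"
proof (induction ls)
  case (Cons a ls)
  then have "top_part ls \<le> a" by (auto simp: top_part_def split: list.split)
  with Cons show ?case
    by (simp add: diagram_word_Cons count_list_replicate del: diagram_word.simps(2,3))
      (simp add: top_part_def)
qed (simp add: top_part_def)

section \<open>Normal ordering of words\<close>

context q_ore_pair
begin

fun letter_val :: "letter \<Rightarrow> 'a" where
  "letter_val LX = X"
| "letter_val LY = Y"

definition word_val :: "letter list \<Rightarrow> 'a" where
  "word_val w = prod_list (map letter_val w)"

lemma word_val_simps [simp]:
  "word_val [] = 1" "word_val (LX # w) = X * word_val w" "word_val (LY # w) = Y * word_val w"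
  "word_val (v @ w) = word_val v * word_val w" "word_val (replicate n LY) = Y ^ n"
  by (simp_all add: word_val_def prod_list_replicate)

text \<open>The index \<open>i\<close> counts the letters \<open>Y\<close> crossed before
  \<open>X\<close> is absorbed. For \<open>p = 0\<close> the sum is empty, which makes the truncated
  exponent \<open>p - 1\<close> harmless.\<close>

lemma X_mult_Y_power:
  "X * Y ^ p = q ^ p *\<^sub>A (Y ^ p * X) + (\<Sum>i<p. q ^ i) *\<^sub>A (\<mu> *\<^sub>A Y ^ (p - 1) + \<nu> *\<^sub>A Y ^ p)"
proof (induction p)
  case (Suc p)
  have XY: "X * Y = q *\<^sub>A (Y * X) + \<mu> *\<^sub>A 1 + \<nu> *\<^sub>A Y"
    using ore_relation by (simp add: algebra_simps)
  have low: "(\<Sum>i<p. q ^ i) *\<^sub>A (Y * (\<mu> *\<^sub>A Y ^ (p - 1) + \<nu> *\<^sub>A Y ^ p)) =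
      (\<Sum>i<p. q ^ i) *\<^sub>A (\<mu> *\<^sub>A Y ^ p + \<nu> *\<^sub>A Y ^ Suc p)"
    by (cases p) (simp_all add: scale_mult_right distrib_left)
  have "X * Y ^ Suc p = q *\<^sub>A (Y * (X * Y ^ p)) + (\<mu> *\<^sub>A Y ^ p + \<nu> *\<^sub>A Y ^ Suc p)"
    using arg_cong[OF XY, of "\<lambda>z. z * Y ^ p"]
    by (simp add: distrib_right scale_mult_left mult.assoc add.assoc)
  also have "Y * (X * Y ^ p) =
      q ^ p *\<^sub>A (Y ^ Suc p * X) + (\<Sum>i<p. q ^ i) *\<^sub>A (\<mu> *\<^sub>A Y ^ p + \<nu> *\<^sub>A Y ^ Suc p)"
    unfolding Suc.IH low[symmetric] by (simp add: distrib_left scale_mult_right mult.assoc)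
  also have "q *\<^sub>A \<dots> = q ^ Suc p *\<^sub>A (Y ^ Suc p * X) +
      (q * (\<Sum>i<p. q ^ i)) *\<^sub>A (\<mu> *\<^sub>A Y ^ p + \<nu> *\<^sub>A Y ^ Suc p)"
    by (simp add: scale_right_distrib mult.assoc)
  also have "\<dots> + (\<mu> *\<^sub>A Y ^ p + \<nu> *\<^sub>A Y ^ Suc p) = q ^ Suc p *\<^sub>A (Y ^ Suc p * X) +
      (1 + q * (\<Sum>i<p. q ^ i)) *\<^sub>A (\<mu> *\<^sub>A Y ^ p + \<nu> *\<^sub>A Y ^ Suc p)"
    by (simp only: scale_left_distrib scale_one add_ac)
  \<comment> \<open>Crossing the first \<open>Y\<close> raises all powers of \<open>q\<close> by
    one; absorption at that \<open>Y\<close> gives the new term 1.\<close>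
  also have "1 + q * (\<Sum>i<p. q ^ i) = (\<Sum>i<Suc p. q ^ i)"
    unfolding sum.lessThan_Suc_shift by (simp add: sum_distrib_left)
  finally show ?case by simp
qed simp

text \<open>Each rook consumes one \<open>X\<close> and one \<open>Y\<close>, each file only one
  \<open>X\<close>, which gives the exponents. Prepending a letter performs the same step on the
  word and on the board.\<close>

lemma word_val_normal_order:
  "word_val w = placement_sum \<mu> \<nu> q (board w)
    (\<lambda>r f. Y ^ (count_list w LY - r) * X ^ (count_list w LX - r - f))"
proof (induction w)
  case Nil
  then show ?case
    by (simp add: board_Nil placement_sum_def placements_empty placement_weight_def
        empty_boxes_def)
next
  case (Cons x w)
  let ?n = "count_list w LY" and ?l = "count_list w LX"
  show ?case
  proof (cases x)
    case LY
    have "Y * Y ^ (?n - card R) = Y ^ (Suc ?n - card R)" if "(R, F) \<in> placements (board w)" for R F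
      using card_rooks_files_le(1)[OF finite_board that board_subset]
      by (simp add: Suc_diff_le)
    then show ?thesis
      unfolding LY word_val_simps Cons.IH board_LY placement_sum_shift[OF finite_board]
        mult_placement_sum
      by (intro placement_sum_cong) (simp add: mult.assoc[symmetric])
  next
    case LX
    have "board w \<subseteq> UNIV \<times> {..<?n}" using board_subset by blast
    note col = placement_sum_add_column[OF finite_board this]
    show ?thesis
      unfolding LX word_val_simps Cons.IH board_LX mult_placement_sum col
    proof (rule placement_sum_cong)
      fix R F assume P: "(R, F) \<in> placements (board w)"
      let ?r = "card R" and ?f = "card F"
      have le: "?r + ?f \<le> ?l"
        by (rule card_rooks_files_le(2)[OF finite_board P board_subset])
      have "X * (Y ^ (?n - ?r) * X ^ (?l - ?r - ?f)) =
          q ^ (?n - ?r) *\<^sub>A (Y ^ (?n - ?r) * (X * X ^ (?l - ?r - ?f))) +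
          (\<Sum>i<?n - ?r. q ^ i) *\<^sub>A (\<mu> *\<^sub>A (Y ^ (?n - ?r - 1) * X ^ (?l - ?r - ?f)) +
            \<nu> *\<^sub>A (Y ^ (?n - ?r) * X ^ (?l - ?r - ?f)))"
        using arg_cong[OF X_mult_Y_power[of "?n - ?r"], of "\<lambda>z. z * X ^ (?l - ?r - ?f)"]
        by (simp add: distrib_right scale_mult_left mult.assoc)
      \<comment> \<open>As \<open>?r + ?f\<close> is at most \<open>?l\<close>, an \<open>X\<close>
        that crosses every surviving \<open>Y\<close> raises the exponent of \<open>X\<close> by
        exactly one.\<close>
      moreover have "Suc ?l - ?r - ?f = Suc (?l - ?r - ?f)" using le by simp
      ultimately show "X * (Y ^ (?n - ?r) * X ^ (?l - ?r - ?f)) =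
          q ^ (?n - ?r) *\<^sub>A (Y ^ (count_list (LX # w) LY - ?r) * X ^ (count_list (LX # w) LX - ?r - ?f)) +
          (\<Sum>i<?n - ?r. q ^ i) *\<^sub>A
            (\<mu> *\<^sub>A (Y ^ (count_list (LX # w) LY - Suc ?r) * X ^ (count_list (LX # w) LX - Suc ?r - ?f)) +
             \<nu> *\<^sub>A (Y ^ (count_list (LX # w) LY - ?r) * X ^ (count_list (LX # w) LX - ?r - Suc ?f)))"
        by simp
    qed
  qed
qed

section \<open>The power as a sum over diagrams\<close>

definition words_sum :: "nat \<Rightarrow> nat \<Rightarrow> 'a" where
  "words_sum a l = (\<Sum>ls\<in>box_diagrams a l. Y ^ (a - top_part ls) * word_val (diagram_word ls))"

lemma words_sum_0_right: "words_sum a 0 = Y ^ a"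
  by (simp add: words_sum_def box_diagrams_0_right top_part_def)

text \<open>With first part equal to the full width \<open>a\<close> there is no \<open>Y\<close> in
  front, and the block after the leading \<open>X\<close> is exactly the initial power of
  \<open>Y\<close> in \<open>words_sum a l\<close>.\<close>

lemma sum_Cons_diagrams:
  "(\<Sum>ls\<in>(#) a ` box_diagrams a l. Y ^ (a - top_part ls) * word_val (diagram_word ls)) =
    X * words_sum a l"
  unfolding words_sum_def
  by (subst sum.reindex)
    (auto simp: sum_distrib_left top_part_def[of "a # _"] diagram_word_Cons
      simp del: diagram_word.simps(2,3) intro!: sum.cong)

lemma words_sum_0_Suc: "words_sum 0 (Suc l) = X * words_sum 0 l"
  using sum_Cons_diagrams[of 0 l] by (simp add: words_sum_def box_diagrams_0_Suc)

text \<open>This is the recursion by first letter for the sum of all words with \<open>Suc a\<close>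
  letters \<open>Y\<close> and \<open>Suc l\<close> letters \<open>X\<close>, which identifies
  \<open>words_sum\<close> as that sum.\<close>

lemma words_sum_Suc_Suc: "words_sum (Suc a) (Suc l) = X * words_sum (Suc a) l + Y * words_sum a (Suc l)"
proof -
  have "words_sum (Suc a) (Suc l) =
      (\<Sum>ls\<in>box_diagrams a (Suc l). Y ^ (Suc a - top_part ls) * word_val (diagram_word ls)) +
      X * words_sum (Suc a) l"
    unfolding words_sum_def[of "Suc a" "Suc l"] box_diagrams_Suc_Suc sum_Cons_diagrams[symmetric]
    by (intro sum.union_disjoint) (simp_all add: finite_box_diagrams box_diagrams_Suc_disjoint)
  also have "(\<Sum>ls\<in>box_diagrams a (Suc l). Y ^ (Suc a - top_part ls) * word_val (diagram_word ls)) =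
      Y * words_sum a (Suc l)"
    unfolding words_sum_def sum_distrib_left
    by (intro sum.cong) (simp_all add: top_part_le Suc_diff_le mult.assoc)
  finally show ?thesis by simp
qed

lemma power_eq_words_sum: "(X + Y) ^ m = (\<Sum>l=0..m. words_sum (m - l) l)"
proof (induction m)
  case 0
  then show ?case by (simp add: words_sum_0_right)
next
  case (Suc m)
  have "(\<Sum>l=0..Suc m. words_sum (Suc m - l) l) =
      Y ^ Suc m + (\<Sum>l=0..m. words_sum (m - l) (Suc l))"
    by (simp add: sum.atLeast0_atMost_Suc_shift words_sum_0_right del: sum.cl_ivl_Suc)
  \<comment> \<open>At \<open>l = m\<close> the words contain no \<open>Y\<close>, so only words
    starting with \<open>X\<close> occur and the second sum stops below \<open>m\<close>.\<close>
  also have "(\<Sum>l=0..m. words_sum (m - l) (Suc l)) = (\<Sum>l=0..m. X * words_sum (m - l) l) +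
      (\<Sum>l<m. Y * words_sum (m - Suc l) (Suc l))"
  proof -
    have "(\<Sum>l<m. words_sum (m - l) (Suc l)) =
        (\<Sum>l<m. X * words_sum (m - l) l + Y * words_sum (m - Suc l) (Suc l))"
    proof (intro sum.cong refl)
      fix l assume "l \<in> {..<m}"
      then have "m - l = Suc (m - Suc l)" by simp
      then show "words_sum (m - l) (Suc l) = X * words_sum (m - l) l + Y * words_sum (m - Suc l) (Suc l)"
        using words_sum_Suc_Suc by metis
    qed
    then show ?thesis
      by (simp add: atLeast0AtMost lessThan_Suc_atMost[symmetric] sum.distrib words_sum_0_Suc add_ac)
  qed
  \<comment> \<open>The separate term \<open>Y ^ Suc m\<close> is \<open>Y\<close> times the missing
    summand for \<open>l = 0\<close> and completes the second sum.\<close>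
  also have "Y ^ Suc m + (\<dots>) = X * (\<Sum>l=0..m. words_sum (m - l) l) + Y * (\<Sum>l=0..m. words_sum (m - l) l)"
    by (simp add: atLeast0AtMost lessThan_Suc_atMost[symmetric] sum.lessThan_Suc_shift
        sum_distrib_left words_sum_0_right distrib_left add_ac del: sum.lessThan_Suc)
  finally show ?case using Suc.IH by (simp add: distrib_right)
qed

text \<open>The initial power of \<open>Y\<close> merges with the power left by normal ordering, so
  the final exponent \<open>m - l - t\<close> no longer depends on the diagram and the coefficients
  can be collected.\<close>

lemma words_sum_eq:
  assumes "l \<le> m"
  shows "words_sum (m - l) l =
    (\<Sum>k=0..l. \<Sum>t=0..l-k. ore_coeff \<mu> \<nu> q m k l t *\<^sub>A (Y ^ (m - l - t) * X ^ k))"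
proof -
  let ?B = "\<lambda>ls. board (diagram_word ls)"
  have "words_sum (m - l) l = (\<Sum>ls\<in>box_diagrams (m - l) l. \<Sum>k=0..l. \<Sum>t=0..l-k.
      mixed_number \<mu> \<nu> q t (l - k - t) (?B ls) *\<^sub>A (Y ^ (m - l - t) * X ^ k))"
    unfolding words_sum_def
  proof (rule sum.cong[OF refl])
    fix ls assume ls: "ls \<in> box_diagrams (m - l) l"
    then have cX: "count_list (diagram_word ls) LX = l" and
      cY: "count_list (diagram_word ls) LY = top_part ls"
      by (auto simp: box_diagrams_def count_LX_diagram_word count_LY_diagram_word)
    note le = card_rooks_files_le[OF finite_board _ board_subset[of "diagram_word ls", unfolded cX cY]]
    \<comment> \<open>Both differences are genuine: \<open>card R\<close> is at most
      \<open>top_part ls\<close>, which is at most \<open>m - l\<close>.\<close>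
    have exponent: "m - l - top_part ls + (top_part ls - card R) = m - l - card R"
      if "(R, F) \<in> placements (?B ls)" for R F
      using le(1)[OF that] top_part_le[OF ls] by simp
    have "Y ^ (m - l - top_part ls) * word_val (diagram_word ls) =
        placement_sum \<mu> \<nu> q (?B ls) (\<lambda>r f. Y ^ (m - l - r) * X ^ (l - r - f))"
      unfolding word_val_normal_order cX cY mult_placement_sum
      by (intro placement_sum_cong)
        (simp only: mult.assoc[symmetric] power_add[symmetric] exponent)
    also have "\<dots> = (\<Sum>k=0..l. \<Sum>t=0..l-k. mixed_number \<mu> \<nu> q t (l - k - t) (?B ls) *\<^sub>A
        (Y ^ (m - l - t) * X ^ (l - t - (l - k - t))))"
      by (rule placement_sum_eq_mixed_numbers[OF finite_board le(2)])
    \<comment> \<open>In the range of summation, \<open>l - t - (l - k - t)\<close> equals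
      \<open>k\<close>.\<close>
    also have "\<dots> = (\<Sum>k=0..l. \<Sum>t=0..l-k. mixed_number \<mu> \<nu> q t (l - k - t) (?B ls) *\<^sub>A
        (Y ^ (m - l - t) * X ^ k))"
      by (intro sum.cong refl arg_cong2[of _ _ _ _ scale] arg_cong2[of _ _ _ _ "(*)"]
          arg_cong2[of _ _ _ _ "(^)"]) auto
    finally show "Y ^ (m - l - top_part ls) * word_val (diagram_word ls) = \<dots>" .
  qed
  also have "\<dots> = (\<Sum>k=0..l. \<Sum>t=0..l-k. \<Sum>ls\<in>box_diagrams (m - l) l.
      mixed_number \<mu> \<nu> q t (l - k - t) (?B ls) *\<^sub>A (Y ^ (m - l - t) * X ^ k))"
    by (subst sum.swap, intro sum.cong refl, rule sum.swap)
  finally show ?thesis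
    by (simp add: ore_coeff_def scale_sum_left)
qed

end

section \<open>Assembly of the expansion\<close>

lemma sum_triangle_swap:
  fixes f :: "nat \<Rightarrow> nat \<Rightarrow> 'b::comm_monoid_add"
  shows "(\<Sum>l=0..m. \<Sum>k=0..l. f k l) = (\<Sum>k=0..m. \<Sum>l=k..m. f k l)"
  by (simp add: sum.Sigma)
    (rule sum.reindex_bij_witness[of _ prod.swap prod.swap], auto)

theorem theorem3p2:
  fixes scale :: "complex \<Rightarrow> 'a::ring_1 \<Rightarrow> 'a"
    and \<mu> \<nu> q :: complex and X Y :: 'a and m :: nat
  assumes "q_ore_pair scale \<mu> \<nu> q X Y"
  shows "(X + Y) ^ m =
    (\<Sum>k=0..m. \<Sum>l=k..m. \<Sum>t=0..l-k.
       scale (ore_coeff \<mu> \<nu> q m k l t) (Y ^ (m - l - t) * X ^ k))"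
proof -
  interpret q_ore_pair scale \<mu> \<nu> q X Y by (rule assms)
  have "(X + Y) ^ m = (\<Sum>l=0..m. \<Sum>k=0..l. \<Sum>t=0..l-k.
      scale (ore_coeff \<mu> \<nu> q m k l t) (Y ^ (m - l - t) * X ^ k))"
    by (simp add: power_eq_words_sum words_sum_eq)
  also have "\<dots> = (\<Sum>k=0..m. \<Sum>l=k..m. \<Sum>t=0..l-k.
      scale (ore_coeff \<mu> \<nu> q m k l t) (Y ^ (m - l - t) * X ^ k))"
    by (rule sum_triangle_swap)
  finally show ?thesis .
qed

end
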